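(* Let $A$ be a Lebesgue measurable 3-sum-free subset of $[0,1]$ (i.e. there are no $x,y,z\in A$, not necessarily distinct, with $x+y=3z$) satisfying $\mu(A)=77/177$. Then there is an $i\in\{1,\dots,7\}$ such that $A\subset \mathcal{A}_i$.
   Context: $\mu$ denotes Lebesgue measure. Let $$\mathcal{A}_0=\left(\tfrac{8}{177},\tfrac{4}{59}\right)\cup\left(\tfrac{28}{177},\tfrac{14}{59}\right)\cup\left(\tfrac23,1\right).$$ The sets $\mathcal{A}_1,\dots,\mathcal{A}_7$ are the seven sets of the form $\mathcal{A}_0\cup\{p_1,p_2,p_3\}$, where $p_1\in\{8/177,4/59\}$, $p_2\in\{28/177,14/59\}$, $p_3\in\{2/3,1\}$ (one endpoint of each of the three intervals), excluding the choice $\{p_1,p_2,p_3\}=\{8/177,14/59,2/3\}$. *)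

theory Defs
  imports "HOL-Analysis.Analysis"
begin

definition three_sum_free :: "real set \<Rightarrow> bool" where
  "three_sum_free A \<longleftrightarrow> (\<forall>x\<in>A. \<forall>y\<in>A. \<forall>z\<in>A. x + y \<noteq> 3 * z)"

definition calA0 :: "real set" where
  "calA0 = {8/177<..<4/59} \<union> {28/177<..<14/59} \<union> {2/3<..<1}"

definition calA_family :: "real set set" where
  "calA_family = {calA0 \<union> {p1, p2, p3} | p1 p2 p3.
      p1 \<in> {8/177, 4/59} \<and> p2 \<in> {28/177, 14/59} \<and> p3 \<in> {2/3, 1} \<and>
      \<not> (p1 = 8/177 \<and> p2 = 14/59 \<and> p3 = 2/3)}"

end

theory Submission
  imports Defs
begin

text \<open>Let \<open>F t\<close> be the measure of \<open>A \<inter> [0, t]\<close>. A 3-sum-free set with top \<open>c\<close> and bottom \<open>m\<close> satisfies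
  \<open>F c - F (c/3) \<le> c/3\<close> and, when its upper third is at least half full, even the descent inequality
  \<open>F c - F (2c/9 + m/3) \<le> c/3\<close>. Taking for the top a maximum point of \<open>F t - 77/177 t\<close>, the set has density at
  least \<open>77/177\<close> below its top at every scale, and a Schnirelmann-type argument then keeps the middle third
  so thin that the upper third is more than half full. One descent step leads to \<open>r = 2c/9 + m/3\<close>, a second one (at a
  maximum point of \<open>F t - 2/5 t\<close> on \<open>[0, r]\<close>) to \<open>s = 2r/9 + m/3\<close>, where \<open>F s \<le> min (s/3) (s - m)\<close>.
  The resulting bound on \<open>F c\<close> is piecewise linear in \<open>m\<close> with maximum \<open>77/177 c\<close>, attained only at \<open>m = 8/177 c\<close>.
  In case of equality \<open>A\<close> has full measure in \<open>[8/177, 12/177]\<close>; full intervals \<open>I\<close> and \<open>J\<close> exclude the interior of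
  \<open>3 * I - J\<close> from \<open>A\<close>, which forces the other two intervals.\<close>

section \<open>Cumulative Lebesgue measure and packing bounds\<close>

text \<open>The set is a parameter because the Schnirelmann argument needs this function for
  auxiliary sets besides \<open>A\<close>.\<close>

definition cum :: "real set \<Rightarrow> real \<Rightarrow> real" where
  "cum X t = measure lebesgue (X \<inter> {..t})"

lemma measure_Un_disjoint:
  "S \<in> fmeasurable M \<Longrightarrow> T \<in> fmeasurable M \<Longrightarrow> S \<inter> T = {} \<Longrightarrow>
    measure M (S \<union> T) = measure M S + measure M T"
  by (simp add: measure_Un3)

lemma lmeasurable_halfopen [simp]: "{x<..y} \<in> lmeasurable" for x y :: real
  by (intro bounded_set_imp_lmeasurable) auto

lemma lmeasurable_Int_interval [simp]:
  fixes X :: "real set"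
  assumes "X \<in> lmeasurable"
  shows "X \<inter> {..x} \<in> lmeasurable" "X \<inter> {x<..y} \<in> lmeasurable"
  using assms by (auto intro!: fmeasurable_Int_fmeasurable)

lemma cum_diff:
  assumes "X \<in> lmeasurable" "x \<le> y"
  shows "cum X y - cum X x = measure lebesgue (X \<inter> {x<..y})"
proof -
  have "X \<inter> {..y} = (X \<inter> {..x}) \<union> (X \<inter> {x<..y})"
    using assms(2) by auto
  moreover have "measure lebesgue ((X \<inter> {..x}) \<union> (X \<inter> {x<..y})) = cum X x + measure lebesgue (X \<inter> {x<..y})"
    unfolding cum_def using assms(1) by (intro measure_Un_disjoint) auto
  ultimately show ?thesis by (simp add: cum_def)
qed

lemma cum_mono: "X \<in> lmeasurable \<Longrightarrow> x \<le> y \<Longrightarrow> cum X x \<le> cum X y"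
  using cum_diff[of X x y] by (metis diff_ge_0_iff_ge measure_nonneg)

lemma cum_lipschitz:
  assumes "X \<in> lmeasurable" "x \<le> y"
  shows "cum X y - cum X x \<le> y - x"
proof -
  have "measure lebesgue (X \<inter> {x<..y}) \<le> measure lebesgue {x<..y}"
    using assms(1) by (intro measure_mono_fmeasurable) auto
  then show ?thesis using cum_diff[OF assms] assms(2) by simp
qed

lemma cum_cont:
  assumes "X \<in> lmeasurable"
  shows "continuous_on S (cum X)"
proof -
  have "1-lipschitz_on S (cum X)"
  proof (rule lipschitz_onI)
    fix x y
    show "dist (cum X x) (cum X y) \<le> 1 * dist x y"
      using cum_lipschitz[OF assms, of x y] cum_lipschitz[OF assms, of y x]
        cum_mono[OF assms, of x y] cum_mono[OF assms, of y x]
      by (cases "x \<le> y") (auto simp: dist_real_def)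
  qed simp
  then show ?thesis by (rule lipschitz_on_continuous_on)
qed

lemma cum_cont_compose [continuous_intros]:
  assumes "X \<in> lmeasurable" "continuous_on S g"
  shows "continuous_on S (\<lambda>x. cum X (g x))"
  using continuous_on_compose2[OF cum_cont[OF assms(1), of UNIV] assms(2)] by auto

lemma lmeasurable_affine_image:
  fixes S :: "real set"
  assumes "S \<in> lmeasurable"
  shows "(\<lambda>t. k * t + d) ` S \<in> lmeasurable" "measure lebesgue ((\<lambda>t. k * t + d) ` S) = \<bar>k\<bar> * measure lebesgue S"
proof -
  have "(\<lambda>t. k * t + d) ` S \<in> sets lebesgue"
    using assms by (intro differentiable_image_in_sets_lebesgue)
      (auto simp: differentiable_on_def intro!: derivative_intros)
  moreover have "emeasure lebesgue ((\<lambda>t. k * t + d) ` S) = ennreal \<bar>k\<bar> * emeasure lebesgue S"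
    using emeasure_lebesgue_affine[of k d S] by simp
  ultimately show "(\<lambda>t. k * t + d) ` S \<in> lmeasurable"
    using assms by (auto simp: fmeasurable_def ennreal_mult_less_top)
  show "measure lebesgue ((\<lambda>t. k * t + d) ` S) = \<bar>k\<bar> * measure lebesgue S"
    using measure_lebesgue_affine[of k d S] by (simp add: add.commute)
qed

lemma measure_packing2:
  fixes x y :: real
  assumes "S \<in> lmeasurable" "T \<in> lmeasurable" "S \<subseteq> {x..y}" "T \<subseteq> {x..y}" "S \<inter> T = {}" "x \<le> y"
  shows "measure lebesgue S + measure lebesgue T \<le> y - x"
proof -
  have "measure lebesgue S + measure lebesgue T = measure lebesgue (S \<union> T)"
    using assms by (intro measure_Un_disjoint[symmetric]) auto
  also have "\<dots> \<le> measure lebesgue {x..y}"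
    using assms by (intro measure_mono_fmeasurable) auto
  finally show ?thesis using assms(6) by simp
qed

lemma measure_packing3:
  fixes x y :: real
  assumes "S \<in> lmeasurable" "T \<in> lmeasurable" "U \<in> lmeasurable"
    "S \<subseteq> {x..y}" "T \<subseteq> {x..y}" "U \<subseteq> {x..y}" "S \<inter> T = {}" "S \<inter> U = {}" "T \<inter> U = {}" "x \<le> y"
  shows "measure lebesgue S + measure lebesgue T + measure lebesgue U \<le> y - x"
proof -
  have "measure lebesgue S + measure lebesgue T = measure lebesgue (S \<union> T)"
    using assms by (intro measure_Un_disjoint[symmetric]) auto
  moreover have "measure lebesgue (S \<union> T) + measure lebesgue U \<le> y - x"
    using assms by (intro measure_packing2) auto
  ultimately show ?thesis by simp
qed

section \<open>Packing inequalities for a 3-sum-free set\<close>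

locale sum_free_set =
  fixes A :: "real set"
  assumes lmeas: "A \<in> lmeasurable" and nonneg: "A \<subseteq> {0..}" and free: "three_sum_free A"
begin

abbreviation F :: "real \<Rightarrow> real" where "F \<equiv> cum A"

lemmas F_diff = cum_diff[OF lmeas]
lemmas F_mono = cum_mono[OF lmeas]
lemmas F_lip = cum_lipschitz[OF lmeas]
lemmas F_cont = cum_cont_compose[OF lmeas]

lemma freeD: "x \<in> A \<Longrightarrow> y \<in> A \<Longrightarrow> z \<in> A \<Longrightarrow> x + y \<noteq> 3 * z"
  using free unfolding three_sum_free_def by blast

lemma F_0: "F 0 = 0"
proof -
  have "A \<inter> {..0} \<subseteq> {0}" using nonneg by auto
  then have "negligible (A \<inter> {..0})" using negligible_subset by blast
  then show "F 0 = 0" by (simp add: cum_def negligible_imp_measure0)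
qed

lemma F_nonneg: "0 \<le> F t"
  by (simp add: cum_def)

lemma F_const:
  assumes "x \<le> y" "A \<inter> {x<..<y} = {}"
  shows "F y = F x"
proof -
  have "A \<inter> {x<..y} \<subseteq> {y}" using assms by (auto simp: less_le)
  then have "negligible (A \<inter> {x<..y})" using negligible_subset by blast
  then show ?thesis using F_diff[OF assms(1)] by (simp add: negligible_imp_measure0)
qed

text \<open>\<open>A\<close> is disjoint from \<open>3 * z - A\<close> and, in \<open>third\<close>, \<open>3 * A - z\<close> is disjoint from \<open>A\<close>
  for \<open>z \<in> A\<close>; stated through the continuous function \<open>F\<close>, both facts pass to the closure of \<open>A\<close>.\<close>

lemma reflection:
  assumes "z \<in> closure A" "x \<le> y"
  shows "F y - F x + F (3*z - x) - F (3*z - y) \<le> y - x"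
proof -
  have A: "F y - F x + F (3*z - x) - F (3*z - y) \<le> y - x" if z: "z \<in> A" for z
  proof -
    let ?S = "A \<inter> {x<..y}" and ?T = "A \<inter> {3*z-y<..3*z-x}"
    let ?T' = "(\<lambda>t. (-1) * t + 3*z) ` ?T"
    have "measure lebesgue ?S + measure lebesgue ?T' \<le> y - x"
    proof (rule measure_packing2)
      show "?T' \<in> lmeasurable" by (intro lmeasurable_affine_image) (simp add: lmeas)
      show "?S \<inter> ?T' = {}" using freeD[OF _ _ z] by fastforce
    qed (use assms lmeas in auto)
    also have "measure lebesgue ?T' = measure lebesgue ?T"
      using lmeasurable_affine_image(2)[of ?T "-1" "3*z"] lmeas by simp
    finally show ?thesis using F_diff[of x y] F_diff[of "3*z-y" "3*z-x"] assms(2) by simp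
  qed
  show ?thesis
    by (rule continuous_le_on_closure[where f="\<lambda>z. F y - F x + F (3*z - x) - F (3*z - y)"])
      (use assms(1) A in \<open>auto intro!: continuous_intros F_cont\<close>)
qed

lemma third:
  assumes "z \<in> closure A" "x \<le> y"
  shows "3 * (F ((z+y)/3) - F ((z+x)/3)) + F y - F x \<le> y - x"
proof -
  have A: "3 * (F ((z+y)/3) - F ((z+x)/3)) + F y - F x \<le> y - x" if z: "z \<in> A" for z
  proof -
    let ?S = "A \<inter> {x<..y}" and ?T = "A \<inter> {(z+x)/3<..(z+y)/3}"
    let ?T' = "(\<lambda>t. 3 * t + (-z)) ` ?T"
    have "measure lebesgue ?S + measure lebesgue ?T' \<le> y - x"
    proof (rule measure_packing2)
      show "?T' \<in> lmeasurable" by (intro lmeasurable_affine_image) (simp add: lmeas)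
      show "?S \<inter> ?T' = {}" using freeD[OF z] by fastforce
    qed (use assms lmeas in auto)
    also have "measure lebesgue ?T' = 3 * measure lebesgue ?T"
      using lmeasurable_affine_image(2)[of ?T "3" "-z"] lmeas by simp
    finally show ?thesis using F_diff[of x y] F_diff[of "(z+x)/3" "(z+y)/3"] assms(2) by simp
  qed
  show ?thesis
    by (rule continuous_le_on_closure[where f="\<lambda>z. 3 * (F ((z+y)/3) - F ((z+x)/3)) + F y - F x"])
      (use assms(1) A in \<open>auto intro!: continuous_intros F_cont\<close>)
qed

text \<open>If \<open>t + b\<close> and \<open>t + c\<close> were both in \<open>3 * A\<close>, reflecting \<open>[b, t]\<close> and \<open>[t, c]\<close> would show that
  \<open>A\<close> fills at most half of \<open>[b, c]\<close>.\<close>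

lemma dense_interval_aux:
  assumes b: "b \<in> A" and c: "c \<in> A" and "b < c" and dense: "c - b < 2 * (F c - F b)"
  shows "3 * (F (2*c/3) - F (2*b/3)) + F c - F b \<le> c - b"
proof -
  let ?S = "A \<inter> {b<..c}" and ?T = "A \<inter> {2*b/3<..(b+c)/3}" and ?U = "A \<inter> {(b+c)/3<..2*c/3}"
  let ?T' = "(\<lambda>t. 3 * t + (-b)) ` ?T" and ?U' = "(\<lambda>t. 3 * t + (-c)) ` ?U"
  have "measure lebesgue ?S + measure lebesgue ?T' + measure lebesgue ?U' \<le> c - b"
  proof (rule measure_packing3)
    show "?T' \<in> lmeasurable" "?U' \<in> lmeasurable"
      by (intro lmeasurable_affine_image; simp add: lmeas)+
    show "?S \<inter> ?T' = {}" using freeD[OF b] by fastforce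
    show "?S \<inter> ?U' = {}" using freeD[OF c] by fastforce
    have False if "x \<in> A" "x' \<in> A" "3*x - b = 3*x' - c" "b < 3*x - b" "3*x - b \<le> c" for x x'
    proof -
      define t where "t = 3*x - b"
      have t: "3*x - b = t" "3*x - t = b" "3*x' - c = t" "3*x' - t = c" "b \<le> t" "t \<le> c"
        using that by (auto simp: t_def)
      have "x \<in> closure A" "x' \<in> closure A" using that closure_subset by auto
      then have "F t - F b + F t - F b \<le> t - b" "F c - F t + F c - F t \<le> c - t"
        using reflection[of x b t] reflection[of x' t c] t by auto
      then show False using dense by argo
    qed
    then show "?T' \<inter> ?U' = {}" by force
  qed (use assms lmeas in auto)
  moreover have "measure lebesgue ?T' = 3 * measure lebesgue ?T" "measure lebesgue ?U' = 3 * measure lebesgue ?U"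
    using lmeasurable_affine_image(2)[of ?T "3" "-b"] lmeasurable_affine_image(2)[of ?U "3" "-c"] lmeas by simp_all
  ultimately show ?thesis
    using F_diff[of b c] F_diff[of "2*b/3" "(b+c)/3"] F_diff[of "(b+c)/3" "2*c/3"] \<open>b < c\<close> by simp
qed

text \<open>The density hypothesis is strict, so it holds eventually along sequences in
  \<open>A\<close> tending to \<open>b\<close> and \<open>c\<close>; the weak conclusion passes to
  the limit.\<close>

lemma dense_interval:
  assumes b: "b \<in> closure A" and c: "c \<in> closure A" and bc: "b < c" and dense: "c - b < 2 * (F c - F b)"
  shows "3 * (F (2*c/3) - F (2*b/3)) + F c - F b \<le> c - b"
proof -
  obtain bs where bs: "\<And>n. bs n \<in> A" "bs \<longlonglongrightarrow> b" using b closure_sequential by metis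
  obtain cs where cs: "\<And>n. cs n \<in> A" "cs \<longlonglongrightarrow> c" using c closure_sequential by metis
  have F: "(\<lambda>n. F (g n)) \<longlonglongrightarrow> F l" if "g \<longlonglongrightarrow> l" for g and l :: real
    using continuous_on_tendsto_compose[OF cum_cont[OF lmeas, of UNIV] that] by simp
  have "(\<lambda>n. cs n - bs n) \<longlonglongrightarrow> c - b"
    by (intro tendsto_intros bs cs)
  then have ev1: "eventually (\<lambda>n. bs n < cs n) sequentially"
    using bc order_tendstoD(1)[of _ "c - b" _ 0] by fastforce
  have "(\<lambda>n. 2 * (F (cs n) - F (bs n)) - (cs n - bs n)) \<longlonglongrightarrow> 2 * (F c - F b) - (c - b)"
    by (intro tendsto_intros F bs cs)
  then have ev2: "eventually (\<lambda>n. cs n - bs n < 2 * (F (cs n) - F (bs n))) sequentially"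
    using dense order_tendstoD(1)[of _ "2 * (F c - F b) - (c - b)" _ 0] by fastforce
  have ev: "eventually (\<lambda>n. 3 * (F (2*cs n/3) - F (2*bs n/3)) + F (cs n) - F (bs n) \<le> cs n - bs n) sequentially"
    using ev1 ev2 by eventually_elim (use dense_interval_aux bs cs in auto)
  show ?thesis
    by (rule tendsto_le[OF _ _ _ ev]) (auto intro!: tendsto_intros F bs cs)
qed

end

section \<open>Thinness of the middle third\<close>

text \<open>Real induction: at the infimum \<open>u\<close> of the points where \<open>g\<close> is
  positive, continuity gives \<open>g u \<le> 0\<close>, and the step then pushes the infimum beyond
  itself.\<close>

lemma continuous_nonpos_induct:
  fixes g :: "real \<Rightarrow> real"
  assumes cont: "continuous_on UNIV g" and base: "g p \<le> 0"
    and step: "\<And>u. p \<le> u \<Longrightarrow> u < c \<Longrightarrow> (\<And>t. p \<le> t \<Longrightarrow> t \<le> u \<Longrightarrow> g t \<le> 0) \<Longrightarrow>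
      \<exists>\<eta>>0. \<forall>s. u \<le> s \<longrightarrow> s \<le> u + \<eta> \<longrightarrow> g s \<le> 0"
    and s: "p \<le> s" "s \<le> c"
  shows "g s \<le> 0"
proof (rule ccontr)
  assume neg: "\<not> g s \<le> 0"
  define N where "N = {t \<in> {p..s}. 0 < g t}"
  define u where "u = Inf N"
  have "s \<in> N" using neg s by (auto simp: N_def)
  have bdd: "bdd_below N" by (auto simp: N_def intro!: bdd_belowI[of _ p])
  have u: "p \<le> u" "u \<le> s"
    using \<open>s \<in> N\<close> bdd by (auto simp: u_def N_def intro!: cInf_greatest cInf_lower)
  have below: "g t \<le> 0" if "p \<le> t" "t < u" for t
  proof (rule ccontr)
    assume "\<not> g t \<le> 0"
    then have "t \<in> N" using that u by (auto simp: N_def)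
    then show False using cInf_lower[OF _ bdd, of t] that by (simp add: u_def)
  qed
  have "g u \<le> 0"
  proof (cases "u = p")
    case False
    then have "p < u" using u by simp
    have "u \<in> closure {p<..<u}" using \<open>p < u\<close> by simp
    then show ?thesis
      by (rule continuous_le_on_closure[OF continuous_on_subset[OF cont subset_UNIV]]) (simp add: below)
  qed (use base in simp)
  then have le: "g t \<le> 0" if "p \<le> t" "t \<le> u" for t
    using below that by (cases "t = u") auto
  have "u < s" using \<open>g u \<le> 0\<close> neg u by (cases "u = s") auto
  then obtain \<eta> where \<eta>: "\<eta> > 0" "\<And>t. u \<le> t \<Longrightarrow> t \<le> u + \<eta> \<Longrightarrow> g t \<le> 0"
    using step[of u] le u s by auto
  have "u + \<eta> \<le> t" if t: "t \<in> N" for t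
  proof (rule ccontr)
    assume "\<not> u + \<eta> \<le> t"
    then have "g t \<le> 0" using \<eta>(2)[of t] cInf_lower[OF t bdd] by (simp add: u_def)
    then show False using t by (simp add: N_def)
  qed
  then have "u + \<eta> \<le> u"
    unfolding u_def using \<open>s \<in> N\<close> by (intro cInf_greatest) auto
  then show False using \<eta>(1) by simp
qed

context sum_free_set
begin

text \<open>A continuous version of Schnirelmann's argument. With \<open>K = 3 * T - c\<close>, in a gap of \<open>K\<close> following
  \<open>q = 3 * z - c\<close> the set \<open>A\<close> avoids \<open>3 * z - A = q + (c - A)\<close>, which has relative density at least \<open>k\<close>
  there, while near \<open>K\<close> itself \<open>A\<close> avoids \<open>3 * A - c\<close>. The open set \<open>V\<close> separates the two regimes.\<close>

lemma schnirelmann_compact: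
  assumes c: "c \<in> closure A" and k: "0 < k" "k \<le> 1/2"
    and top: "\<And>t. 0 \<le> t \<Longrightarrow> t \<le> c \<Longrightarrow> k * (c - t) \<le> F c - F t"
    and x: "c/3 \<le> x"
    and T: "compact T" "T \<noteq> {}" "T \<subseteq> A \<inter> {x..2*c/3}"
    and "0 < e"
  shows "3 * (1 - k) * measure lebesgue T \<le> (1 - 2*k) * (2*c - 3*x) + e"
proof -
  define K where "K = (\<lambda>t. 3 * t + (-c)) ` T"
  have "compact K" unfolding K_def by (intro compact_continuous_image continuous_intros T)
  have "K \<noteq> {}" using T by (simp add: K_def)
  define p where "p = Inf K"
  have "p \<in> K" unfolding p_def using \<open>compact K\<close> \<open>K \<noteq> {}\<close>
    by (intro closed_contains_Inf) (auto simp: compact_imp_closed bounded_imp_bdd_below compact_imp_bounded)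
  have Kp: "p \<le> t" if "t \<in> K" for t
    unfolding p_def using that \<open>compact K\<close> by (intro cInf_lower) (auto simp: bounded_imp_bdd_below compact_imp_bounded)
  have Kc: "t \<le> c" "3*x - c \<le> t" "(t + c)/3 \<in> A" if "t \<in> K" for t
    using that T(3) by (auto simp: K_def)
  have "K \<in> lmeasurable" using \<open>compact K\<close> by (rule lmeasurable_compact)
  have p: "0 \<le> p" "3*x - c \<le> p" "p \<le> c" using Kc[OF \<open>p \<in> K\<close>] x by auto
  obtain V where V: "open V" "K \<subseteq> V" "V - K \<in> lmeasurable" "emeasure lebesgue (V - K) < ennreal e"
    using sets_lebesgue_outer_open[of K e] \<open>K \<in> lmeasurable\<close> \<open>0 < e\<close> by (auto dest: fmeasurableD)
  define W where "W = V - K"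
  have W: "W \<in> lmeasurable" using V by (simp add: W_def)
  have We: "measure lebesgue W < e"
    using V(3,4) by (simp add: W_def emeasure_eq_measure2 ennreal_less_iff)
  \<comment> \<open>Nonpositivity bounds the measure of \<open>A\<close> in \<open>[p, s]\<close> by
    \<open>1 - k\<close> times that of the complement of \<open>K\<close>, plus the error
    \<open>W\<close>.\<close>
  define g where "g s = F s - F p - (1 - k) * (s - p - (cum K s - cum K p)) - (cum W s - cum W p)" for s
  have "g c \<le> 0"
  proof (rule continuous_nonpos_induct[where g=g and p=p and c=c])
    show "continuous_on UNIV g" unfolding g_def
      by (intro continuous_intros F_cont cum_cont_compose[OF W] cum_cont_compose[OF \<open>K \<in> lmeasurable\<close>])
    show "g p \<le> 0" by (simp add: g_def)
    fix u assume u: "p \<le> u" "u < c" and IH: "\<And>t. p \<le> t \<Longrightarrow> t \<le> u \<Longrightarrow> g t \<le> 0"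
    show "\<exists>\<eta>>0. \<forall>s. u \<le> s \<longrightarrow> s \<le> u + \<eta> \<longrightarrow> g s \<le> 0"
    proof (cases "u \<in> K")
      case True
      then obtain \<eta> where \<eta>: "\<eta> > 0" "cball u \<eta> \<subseteq> V"
        using V(1,2) by (meson open_contains_cball subsetD)
      have "g s \<le> 0" if s: "u \<le> s" "s \<le> u + \<eta>" for s
      proof -
        have sub: "{u<..s} \<subseteq> V" using \<eta>(2) s by (force simp: dist_real_def)
        have "K \<inter> {u<..s} \<union> W \<inter> {u<..s} = {u<..s}" using sub V(2) by (auto simp: W_def)
        moreover have "measure lebesgue (K \<inter> {u<..s} \<union> W \<inter> {u<..s}) =
            (cum K s - cum K u) + (cum W s - cum W u)"
          using s W \<open>K \<in> lmeasurable\<close>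
          by (subst measure_Un_disjoint) (auto simp: cum_diff W_def)
        ultimately have sum: "(cum K s - cum K u) + (cum W s - cum W u) = s - u"
          using s by simp
        have "measure lebesgue (K \<inter> {u<..s}) \<le>
            measure lebesgue ((\<lambda>t. 3 * t + (-c)) ` (A \<inter> {(c+u)/3<..(c+s)/3}))"
        proof (rule measure_mono_fmeasurable)
          show "K \<inter> {u<..s} \<subseteq> (\<lambda>t. 3 * t + (-c)) ` (A \<inter> {(c+u)/3<..(c+s)/3})"
            using T(3) by (auto simp: K_def)
          show "(\<lambda>t. 3 * t + (-c)) ` (A \<inter> {(c+u)/3<..(c+s)/3}) \<in> lmeasurable"
            by (intro lmeasurable_affine_image) (simp add: lmeas)
        qed (use \<open>K \<in> lmeasurable\<close> in \<open>auto dest: fmeasurableD\<close>)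
        also have "\<dots> = 3 * (F ((c+s)/3) - F ((c+u)/3))"
          using s by (simp only: lmeasurable_affine_image(2)[OF lmeasurable_Int_interval(2)[OF lmeas]])
            (simp add: F_diff)
        finally have "cum K s - cum K u \<le> 3 * (F ((c+s)/3) - F ((c+u)/3))"
          using cum_diff[OF \<open>K \<in> lmeasurable\<close> s(1)] by simp
        \<comment> \<open>\<open>third\<close> leaves \<open>A\<close> only the part of
          \<open>(u, s]\<close> outside \<open>K\<close>, which is \<open>W\<close>.\<close>
        then have 1: "F s - F u \<le> cum W s - cum W u"
          using third[OF c s(1)] sum by linarith
        have "0 \<le> cum W s - cum W u" using cum_mono[OF W s(1)] by simp
        then have "0 \<le> (1 - k) * (s - u - (cum K s - cum K u))"
          using sum k by (intro mult_nonneg_nonneg) auto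
        then have "g s \<le> g u" using 1 by (simp add: g_def algebra_simps)
        then show ?thesis using IH[OF u(1)] by simp
      qed
      then show ?thesis using \<eta>(1) by blast
    next
      case False
      have "open (-K)" using \<open>compact K\<close> by (simp add: compact_imp_closed open_Compl)
      then obtain r where r: "r > 0" "cball u r \<subseteq> -K"
        using False by (meson ComplI open_contains_cball)
      define \<eta> where "\<eta> = min r (c - u)"
      define q where "q = Sup (K \<inter> {..u})"
      have "compact (K \<inter> {..u})" using \<open>compact K\<close> by (intro compact_Int_closed) auto
      moreover have "K \<inter> {..u} \<noteq> {}" using \<open>p \<in> K\<close> u by auto
      ultimately have q: "q \<in> K \<inter> {..u}"
        unfolding q_def by (intro closed_contains_Sup) (auto simp: compact_imp_closed bounded_imp_bdd_above compact_imp_bounded)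
      have q_max: "t \<le> q" if "t \<in> K" "t \<le> u" for t
        unfolding q_def using that by (intro cSup_upper bdd_aboveI[of _ u]) auto
      have "g s \<le> 0" if s: "u \<le> s" "s \<le> u + \<eta>" for s
      proof -
        have sc: "s \<le> c" "q \<le> s" using s q by (auto simp: \<eta>_def)
        have "K \<inter> {q<..s} = {}"
        proof -
          have "t \<notin> K" if "q < t" "t \<le> s" for t
          proof (cases "t \<le> u")
            case True then show ?thesis using q_max[of t] that by auto
          next
            case False
            then have "t \<in> cball u r" using that s by (auto simp: dist_real_def \<eta>_def)
            then show ?thesis using r by auto
          qed
          then show ?thesis by auto
        qed
        then have K0: "cum K s = cum K q" using cum_diff[OF \<open>K \<in> lmeasurable\<close> sc(2)] by simp
        have "(q + c)/3 \<in> closure A" using Kc(3)[of q] q closure_subset by auto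
        then have "F s - F q + F c - F (c - (s - q)) \<le> s - q"
          using reflection[of "(q+c)/3" q s] sc by (simp add: algebra_simps add_divide_distrib)
        moreover have "k * (s - q) \<le> F c - F (c - (s - q))"
          using top[of "c - (s - q)"] sc q Kp[of q] p by auto
        ultimately have 1: "F s - F q \<le> (1 - k) * (s - q)" by (simp add: algebra_simps)
        \<comment> \<open>The comparison is with \<open>q\<close>, not \<open>u\<close>: the rate
          \<open>1 - k\<close> holds only when measured from the start of the gap.\<close>
        have "g s \<le> g q" using 1 K0 cum_mono[OF W sc(2)] by (simp add: g_def algebra_simps)
        then show ?thesis using IH[of q] q Kp[of q] by auto
      qed
      moreover have "\<eta> > 0" using r u by (simp add: \<eta>_def)
      ultimately show ?thesis by blast
    qed
  qed (use p in auto)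
  moreover have "cum K c - cum K p = measure lebesgue K"
  proof -
    have "K \<inter> {..c} = K" using Kc by auto
    moreover have "K \<inter> {..p} = {p}" using Kp \<open>p \<in> K\<close> by (auto intro!: order.antisym)
    ultimately show ?thesis by (simp add: cum_def)
  qed
  moreover have "cum W c - cum W p \<le> e"
  proof -
    have "cum W c \<le> measure lebesgue W"
      unfolding cum_def using W by (intro measure_mono_fmeasurable) (auto dest: fmeasurableD)
    then show ?thesis using We by (simp add: cum_def) (smt (verit) measure_nonneg)
  qed
  moreover have "k * (c - p) \<le> F c - F p" using top[of p] p by simp
  ultimately have 1: "(1 - k) * measure lebesgue K \<le> (1 - 2*k) * (c - p) + e"
    by (simp add: g_def algebra_simps)
  have 2: "(1 - 2*k) * (c - p) \<le> (1 - 2*k) * (2*c - 3*x)"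
    using p k by (intro mult_left_mono) auto
  have 3: "measure lebesgue K = 3 * measure lebesgue T"
    unfolding K_def using lmeasurable_affine_image(2)[OF lmeasurable_compact[OF T(1)], of 3 "-c"] by simp
  show ?thesis using 1 2 unfolding 3 by (simp add: algebra_simps)
qed

text \<open>Inner regularity reduces this to a compact part of \<open>A\<close>; losing measure
  \<open>e/6\<close> costs at most \<open>e/2\<close>.\<close>

lemma schnirelmann:
  assumes c: "c \<in> closure A" and k: "0 < k" "k \<le> 1/2"
    and top: "\<And>t. 0 \<le> t \<Longrightarrow> t \<le> c \<Longrightarrow> k * (c - t) \<le> F c - F t"
    and x: "c/3 \<le> x" "x \<le> 2*c/3"
  shows "3 * (1 - k) * (F (2*c/3) - F x) \<le> (1 - 2*k) * (2*c - 3*x)"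
proof (rule field_le_epsilon)
  fix e :: real assume "0 < e"
  define B where "B = A \<inter> {x<..2*c/3}"
  have B: "B \<in> lmeasurable" using lmeas by (simp add: B_def)
  obtain T where T: "closed T" "T \<subseteq> B" "B - T \<in> lmeasurable" "emeasure lebesgue (B - T) < ennreal (e/6)"
    using sets_lebesgue_inner_closed[of B "e/6"] B \<open>0 < e\<close> by (auto dest: fmeasurableD)
  have "bounded T" by (rule bounded_subset[of "{x..2*c/3}"]) (use T(2) in \<open>auto simp: B_def\<close>)
  then have "compact T" using T(1) by (simp add: compact_eq_bounded_closed)
  have "measure lebesgue (B - T) < e/6"
    using T(3,4) by (simp add: emeasure_eq_measure2 ennreal_less_iff)
  moreover have "measure lebesgue B = measure lebesgue T + measure lebesgue (B - T)"
    using T(2,3) lmeasurable_compact[OF \<open>compact T\<close>]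
    by (subst measure_Un_disjoint[symmetric]) (auto intro!: arg_cong[where f="measure lebesgue"])
  ultimately have BT: "F (2*c/3) - F x \<le> measure lebesgue T + e/6"
    using F_diff[OF x(2)] by (simp add: B_def)
  have "3 * (1 - k) * measure lebesgue T \<le> (1 - 2*k) * (2*c - 3*x) + e/2"
  proof (cases "T = {}")
    case True
    then show ?thesis using \<open>0 < e\<close> x k by (simp add: add_nonneg_nonneg)
  next
    case False
    then show ?thesis
      using T(2) \<open>0 < e\<close> by (intro schnirelmann_compact[OF c k top x(1) \<open>compact T\<close>]) (auto simp: B_def)
  qed
  moreover have "3 * (1 - k) * (F (2*c/3) - F x) \<le> 3 * (1 - k) * (measure lebesgue T + e/6)"
    using BT k by (intro mult_left_mono) auto
  moreover have "3 * (1 - k) * (e/6) \<le> e/2" using k \<open>0 < e\<close> by (simp add: algebra_simps)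
  ultimately show "3 * (1 - k) * (F (2*c/3) - F x) \<le> (1 - 2*k) * (2*c - 3*x) + e"
    by (simp add: algebra_simps)
qed

section \<open>Mass of the upper two thirds\<close>

text \<open>Moves an endpoint into the closure of \<open>A\<close>, where \<open>reflection\<close>
  and \<open>third\<close> apply, without changing \<open>F\<close>.\<close>

lemma first_point:
  assumes "A \<inter> {x..y} \<noteq> {}"
  obtains v where "v \<in> closure A" "x \<le> v" "v \<le> y" "F v = F x"
proof
  let ?v = "Inf (A \<inter> {x..y})"
  have bdd: "bdd_below (A \<inter> {x..y})" by (rule bdd_belowI[of _ x]) auto
  show "?v \<in> closure A"
    using closure_contains_Inf[OF assms bdd] closure_mono[of "A \<inter> {x..y}" A] by auto
  show x: "x \<le> ?v" using assms by (intro cInf_greatest) auto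
  show y: "?v \<le> y" using assms cInf_lower[OF _ bdd] by force
  have "A \<inter> {x<..<?v} = {}"
  proof -
    have "z \<notin> A" if "x < z" "z < ?v" for z
      using cInf_lower[OF _ bdd, of z] that y by auto
    then show ?thesis by auto
  qed
  then show "F ?v = F x" by (rule F_const[OF x])
qed

lemma last_point:
  assumes "A \<inter> {x..y} \<noteq> {}"
  obtains v where "v \<in> closure A" "x \<le> v" "v \<le> y" "F v = F y"
proof
  let ?v = "Sup (A \<inter> {x..y})"
  have bdd: "bdd_above (A \<inter> {x..y})" by (rule bdd_aboveI[of _ y]) auto
  show "?v \<in> closure A"
    using closure_contains_Sup[OF assms bdd] closure_mono[of "A \<inter> {x..y}" A] by auto
  show x: "x \<le> ?v" using assms cSup_upper[OF _ bdd] by force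
  show y: "?v \<le> y" using assms by (intro cSup_least) auto
  have "A \<inter> {?v<..<y} = {}"
  proof -
    have "z \<notin> A" if "?v < z" "z < y" for z
      using cSup_upper[OF _ bdd, of z] that x by auto
    then show ?thesis by auto
  qed
  then show "F ?v = F y" using F_const[OF y] by simp
qed

lemma F_cmp:
  "x \<le> y \<and> F x \<le> F y \<and> F y - F x \<le> y - x \<or> y \<le> x \<and> F y \<le> F x \<and> F x - F y \<le> x - y"
  using F_mono[of x y] F_lip[of x y] F_mono[of y x] F_lip[of y x] by linarith

lemma F_diff_le_max: "3 * (F (y/3) - F (x/3)) \<le> max 0 (y - x)"
  using F_mono[of "y/3" "x/3"] F_lip[of "x/3" "y/3"] by (cases "x \<le> y") auto

lemma F_empty: "x \<le> y \<Longrightarrow> A \<inter> {x..y} = {} \<Longrightarrow> F y = F x"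
  by (rule F_const) auto

text \<open>With \<open>v\<close> and \<open>b\<close> the first points of \<open>A\<close> in the middle and upper third of \<open>[0, c]\<close>, the triples of
  the points in the middle third avoid \<open>v + A\<close>, \<open>b + A\<close> and \<open>c + A\<close>, which nearly cover \<open>[3 * v, 2 * c]\<close>.\<close>

lemma upper_two_thirds_aux:
  assumes c: "c \<in> closure A" "0 \<le> c"
  shows "F c - F (c/3) \<le> c/3"
proof (cases "A \<inter> {2*c/3..c} = {} \<or> A \<inter> {c/3..2*c/3} = {}")
  case True
  then show ?thesis
    using F_empty[of "2*c/3" c] F_empty[of "c/3" "2*c/3"] F_lip[of "c/3" "2*c/3"] F_lip[of "2*c/3" c] c by auto
next
  case False
  obtain b where b: "b \<in> closure A" "2*c/3 \<le> b" "b \<le> c" "F b = F (2*c/3)"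
    using first_point False by metis
  obtain v where v: "v \<in> closure A" "c/3 \<le> v" "v \<le> 2*c/3" "F v = F (c/3)"
    using first_point False by metis
  have T1: "3 * (F ((b+c)/3) - F (2*b/3)) + F c - F b \<le> c - b"
    using third[OF b(1) b(3)] by simp
  have T2: "3 * (F (2*c/3) - F ((b+c)/3)) + F c - F b \<le> c - b"
    using third[OF c(1) b(3)] by (simp add: add.commute)
  show ?thesis
  \<comment> \<open>\<open>third\<close> at \<open>v\<close> needs \<open>2 * v \<le> c\<close>.
    Otherwise \<open>v\<close> lies so far right that length alone suffices to bound
    \<open>A\<close> on \<open>[v, 2*b/3]\<close>.\<close>
  proof (cases "2 * v \<le> c")
    case True
    have T3: "3 * (F ((v+c)/3) - F v) + F c - F (2 * v) \<le> c - 2 * v"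
      using third[OF v(1) True] by simp
    have "F (2*b/3) \<le> F ((v+c)/3) \<and> 2*b \<le> v + c \<or> 3 * (F (2*b/3) - F ((v+c)/3)) \<le> 2*b - (v+c) \<and> v + c \<le> 2*b"
    proof (cases "2*b \<le> v + c")
      case True
      then show ?thesis using F_mono[of "2*b/3" "(v+c)/3"] by simp
    next
      case False
      then have "F (2*b/3) - F ((v+c)/3) \<le> 2*b/3 - (v+c)/3" by (intro F_lip) simp
      then have "3 * (F (2*b/3) - F ((v+c)/3)) \<le> 2*b - (v+c)" by argo
      then show ?thesis using False by simp
    qed
    moreover have "F (2 * v) - F b \<le> 2 * v - b \<and> b \<le> 2 * v \<or> F b = F (2 * v) \<and> 2 * v \<le> b"
      using F_cmp[of "2 * v" b] F_mono[of "2*c/3" "2 * v"] b(4) v(2) by auto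
    moreover have "3 * (2 * v) \<ge> 2*c" using v by simp
    ultimately show ?thesis
      using T1 T2 T3 b(2,3,4) v(2,3,4) by (elim disjE conjE; argo)
  next
    case False
    then show ?thesis
      using F_cmp[of "2*b/3" v] T1 T2 b(2,3,4) v(2,3,4) c(2) F_lip[OF b(3)] by (elim disjE conjE; argo)
  qed
qed

lemma upper_two_thirds:
  assumes "0 \<le> x"
  shows "F x - F (x/3) \<le> x/3"
proof (cases "A \<inter> {x/3..x} = {}")
  case True
  then show ?thesis using F_empty[of "x/3" x] assms by simp
next
  case False
  obtain c where "c \<in> closure A" "x/3 \<le> c" "c \<le> x" "F c = F x" using last_point[OF False] by blast
  then show ?thesis using upper_two_thirds_aux[of c] F_mono[of "c/3" "x/3"] assms by simp
qed

section \<open>The descent inequality\<close>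

text \<open>As before, but density of the upper third makes \<open>dense_interval\<close> available, so that \<open>b + A\<close> and
  \<open>c + A\<close> count only once, and \<open>m + A\<close> can be used below \<open>c/3\<close>.\<close>

lemma descent_aux:
  assumes c: "c \<in> closure A" and m: "m \<in> closure A" "0 \<le> m" "m \<le> c/3"
    and b: "b \<in> closure A" "2*c/3 \<le> b" "b < c" "F b = F (2*c/3)"
    and dense: "c - b < 2 * (F c - F b)"
    and v: "v \<in> closure A" "c/3 \<le> v" "v \<le> 2*c/3" "F v = F (c/3)"
    and bmv: "b - 2*c/3 \<le> m \<or> b - 2*c/3 \<le> 3 * v - c"
  shows "F c - F (2*c/9 + m/3) \<le> c/3"
proof -
  have TM: "3 * (F ((m+c)/3) - F ((m+b)/3)) + F c - F b \<le> c - b"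
    using third[OF m(1), of b c] b by simp
  have TV: "3 * (F ((v+c)/3) - F ((v+b)/3)) + F c - F b \<le> c - b"
    using third[OF v(1), of b c] b by simp
  have D: "3 * (F (2*c/3) - F (2*b/3)) + F c - F b \<le> c - b"
    using dense_interval[OF b(1) c b(3) dense] .
  have low: "F ((m+b)/3) - F (2*c/9 + m/3) \<le> (m+b)/3 - (2*c/9 + m/3)"
    using b by (intro F_lip) simp
  have mid: "F (c/3) \<le> F ((m+c)/3)" using m by (intro F_mono) simp
  \<comment> \<open>\<open>G\<close> is the measure \<open>A\<close> misses in
    \<open>[b, c]\<close>. As \<open>F b = F (2*c/3)\<close>, the upper third misses
    \<open>G + (b - 2*c/3)\<close>, and the claim is a bound by three times this.\<close>
  define G where "G = c - b - (F c - F b)"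
  have G0: "0 \<le> G" using F_lip[of b c] b(3) by (simp add: G_def)
  have TM': "3 * (F ((m+c)/3) - F (2*c/9 + m/3)) \<le> G + (b - 2*c/3)"
    using TM low by (simp add: G_def field_simps)
  have "3 * (F (2*c/3) - F (2*c/9 + m/3)) \<le> 3 * G + 3 * (b - 2*c/3)"
  proof (cases "2 * v \<le> c")
    case False
    have "3 * (F (2*b/3) - F v) \<le> 2 * (b - 2*c/3)"
      using F_cmp[of v "2*b/3"] False b(2) m(2,3) by argo
    then show ?thesis using TM' D mid v(4) G0 G_def by argo
  next
    case True
    have gap3: "3 * (F (2*b/3) - F ((v+c)/3)) \<le> max 0 (2*b - v - c)"
      using F_diff_le_max[of "2*b" "v+c"] by (simp add: diff_diff_eq)
    have gap3': "max 0 (2*b - v - c) \<le> 2 * (b - 2*c/3)" using b(2) v(2) by simp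
    show ?thesis
    proof (cases "b \<le> 2 * v")
      case True
      have "F ((v+b)/3) \<le> F v" using True by (intro F_mono) simp
      then show ?thesis using TM' TV D mid v(4) gap3 gap3' G_def by argo
    next
      case False
      have gap2: "3 * (F ((v+b)/3) - F v) \<le> b - 2 * v"
        using F_lip[of v "(v+b)/3"] False by (simp add: field_simps)
      have gap2': "3 * (F ((v+b)/3) - F ((m+c)/3)) \<le> max 0 (v + b - m - c)"
        using F_diff_le_max[of "v+b" "m+c"] by (simp add: diff_diff_eq)
      \<comment> \<open>After \<open>TM'\<close>, \<open>TV\<close> and \<open>D\<close> the
        uncovered gaps may cost \<open>2 * (b - 2*c/3)\<close>. The third case counts from
        \<open>(m+c)/3\<close>, where \<open>TM'\<close> ends, instead of from
        \<open>v\<close>.\<close>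
      consider "2*b \<le> v + c" | "b - 2*c/3 \<le> 3 * v - c" | "b - 2*c/3 \<le> m" "v + c \<le> 2*b"
        using bmv by argo
      then show ?thesis
      proof cases
        case 1
        then have "max 0 (2*b - v - c) = 0" by simp
        then show ?thesis using TM' TV D mid v(2,4) b(2) gap3 gap2 G_def by argo
      next
        case 2
        then have "b - 2 * v + max 0 (2*b - v - c) \<le> 2 * (b - 2*c/3)"
          using v(2) b(2) by (simp add: max_def)
        then show ?thesis using TM' TV D mid v(4) gap3 gap2 G_def by argo
      next
        case 3
        then have "max 0 (v + b - m - c) + max 0 (2*b - v - c) \<le> 2 * (b - 2*c/3)"
          using v(2) b(2) by (simp add: max_def)
        then show ?thesis using TM' TV D gap3 gap2' G_def by argo
      qed
    qed
  qed
  then show ?thesis using b(4) by (simp add: G_def)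
qed

text \<open>\<open>b\<close> and \<open>v\<close> are chosen inside the proof as first points, so
  \<open>bv\<close> quantifies over all candidates. The first descent will verify the alternative
  with \<open>v\<close>, the second the one with \<open>m\<close>.\<close>

lemma descent:
  assumes c: "c \<in> closure A" "0 < c" and m: "m \<in> closure A" "0 \<le> m" "m \<le> c/3"
    and dense: "c/3 < 2 * (F c - F (2*c/3))"
    and bv: "\<And>b v. v \<in> closure A \<Longrightarrow> c/3 \<le> v \<Longrightarrow> v \<le> 2*c/3 \<Longrightarrow> b - 2*c/3 \<le> c/3 - (F c - F (2*c/3)) \<Longrightarrow>
      b - 2*c/3 \<le> m \<or> b - 2*c/3 \<le> 3 * v - c"
  shows "F c - F (2*c/9 + m/3) \<le> c/3"
proof -
  have "A \<inter> {2*c/3..c} \<noteq> {}"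
    using F_empty[of "2*c/3" c] dense c by auto
  then obtain b where b: "b \<in> closure A" "2*c/3 \<le> b" "b \<le> c" "F b = F (2*c/3)"
    using first_point by metis
  have "b < c" using b dense c by (cases "b = c") auto
  show ?thesis
  proof (cases "A \<inter> {c/3..2*c/3} = {}")
    case True
    then have "F (2*c/3) = F (c/3)" using F_empty[of "c/3" "2*c/3"] c by simp
    moreover have "3 * (F ((m+c)/3) - F ((m + 2*c/3)/3)) + F c - F (2*c/3) \<le> c - 2*c/3"
      using third[OF m(1), of "2*c/3" c] c by simp
    moreover have "(m + 2*c/3)/3 = 2*c/9 + m/3" by simp
    moreover have "F (c/3) \<le> F ((m+c)/3)" using m by (intro F_mono) simp
    moreover have "F c - F (2*c/3) \<le> c - 2*c/3" using c by (intro F_lip) simp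
    ultimately show ?thesis by simp
  next
    case False
    then obtain v where v: "v \<in> closure A" "c/3 \<le> v" "v \<le> 2*c/3" "F v = F (c/3)"
      using first_point by metis
    show ?thesis
    proof (rule descent_aux[OF c(1) m b(1,2) \<open>b < c\<close> b(4) _ v])
      show "c - b < 2 * (F c - F b)" using b dense by simp
      show "b - 2*c/3 \<le> m \<or> b - 2*c/3 \<le> 3 * v - c"
        using bv[OF v(1-3), of b] F_lip[OF b(3)] b(4) by simp
    qed
  qed
qed

lemma descent_top:
  assumes c: "c \<in> closure A" "0 < c" and m: "m \<in> closure A" "0 \<le> m" "F m = 0"
    and top: "\<And>t. 0 \<le> t \<Longrightarrow> t \<le> c \<Longrightarrow> 77/177 * (c - t) \<le> F c - F t"
  shows "F c - F (2*c/9 + m/3) \<le> c/3"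
proof (cases "m \<le> c/3")
  case False
  then have "F (c/3) \<le> 0" using F_mono[of "c/3" m] m by simp
  then show ?thesis using upper_two_thirds[of c] c F_nonneg[of "2*c/9 + m/3"] by simp
next
  case True
  \<comment> \<open>For \<open>k = 77/177\<close> the quotient of \<open>1 - 2*k\<close> by
    \<open>3 * (1 - k)\<close> is \<open>23/300\<close>.\<close>
  have S: "F (2*c/3) - F x \<le> 23/300 * (2*c - 3*x)" if "c/3 \<le> x" "x \<le> 2*c/3" for x
    using schnirelmann[OF c(1), of "77/177" x] top that by simp
  have a3: "32/150 * c < F c - F (2*c/3)"
    using S[of "c/3"] top[of "c/3"] c F_nonneg[of "c/3"] by simp
  show ?thesis
  proof (rule descent[OF c m(1,2) True])
    show "c/3 < 2 * (F c - F (2*c/3))" using a3 c by simp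
    fix b v assume v: "v \<in> closure A" "c/3 \<le> v" "v \<le> 2*c/3" and b: "b - 2*c/3 \<le> c/3 - (F c - F (2*c/3))"
    have "b - 2*c/3 \<le> 3 * v - c"
    proof (rule ccontr)
      assume "\<not> b - 2*c/3 \<le> 3 * v - c"
      then have p: "3 * v - c < 3/25 * c" using a3 b by simp
      define p where "p = 3 * v - c"
      have p0: "0 \<le> p" "p < 3/25 * c" using p v by (auto simp: p_def)
      \<comment> \<open>Reflection in \<open>v\<close> pairs \<open>[p, p + c/3]\<close> with the
        upper third, and \<open>S\<close> bounds the rest; for \<open>p < 3/25 * c\<close> the total
        is too small for density \<open>77/177\<close> above \<open>p\<close>.\<close>
      have "F (p + c/3) - F p + F c - F (2*c/3) \<le> c/3"
        using reflection[OF v(1), of p "p + c/3"] c by (simp add: p_def)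
      moreover have "F (2*c/3) - F (p + c/3) \<le> 23/300 * (2*c - 3*(p + c/3))"
        using p0 c by (intro S) auto
      moreover have "77/177 * (c - p) \<le> F c - F p"
        using p0 c by (intro top) auto
      ultimately show False using p0 c(2) by (simp add: field_simps)
    qed
    then show "b - 2*c/3 \<le> m \<or> b - 2*c/3 \<le> 3 * v - c" ..
  qed
qed

section \<open>Two descents and the extremal values\<close>

text \<open>\<open>m\<close> need not be the infimum of \<open>A\<close>; this freedom later rules
  out points of \<open>A\<close> below \<open>8/177\<close>.\<close>

lemma extremal_values:
  assumes c: "c \<in> closure A" "0 < c" and m: "m \<in> closure A" "0 \<le> m" "F m = 0"
    and top: "\<And>t. 0 \<le> t \<Longrightarrow> t \<le> c \<Longrightarrow> 77/177 * (c - t) \<le> F c - F t"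
  shows "F c \<le> 77/177 * c" "m = 8/177 * c" "F (12/177 * c) = 4/177 * c" "F (42/177 * c) = 18/177 * c"
proof -
  define r where "r = 2*c/9 + m/3"
  have 1: "F c - F r \<le> c/3" unfolding r_def by (rule descent_top[OF c m top])
  have Fc: "77/177 * c \<le> F c" using top[of 0] c F_0 by simp
  have r_pos: "0 < r" using c m by (simp add: r_def)
  have Fr: "18/177 * c \<le> F r" using 1 Fc by simp
  have "m < c" using F_mono[of c m] Fc c m by force
  then have "r < c" using c by (simp add: r_def)
  have r18: "18/77 * c \<le> r" using top[of r] 1 r_pos \<open>r < c\<close> by (simp add: field_simps)
  have m_low: "3 * (18/77 - 2/9) * c \<le> m" using r18 by (simp add: r_def field_simps)
  have mr: "F r \<le> r - m \<and> m \<le> r \<or> r \<le> m \<and> F r \<le> 0"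
    using F_cmp[of m r] m(3) by linarith
  \<comment> \<open>\<open>c \<le> 12 * m\<close> means \<open>r/3 \<le> m\<close>, which caps
    \<open>F r\<close> at \<open>r/3\<close>; together with \<open>mr\<close> this contradicts
    \<open>Fr\<close>.\<close>
  have m_high: "12 * m < c"
  proof (rule ccontr)
    assume "\<not> 12 * m < c"
    then have "F (r/3) \<le> 0" using F_mono[of "r/3" m] m by (simp add: r_def)
    then have "F r \<le> r/3" using upper_two_thirds[of r] r_pos by simp
    then show False using Fr mr c m by (auto simp: r_def field_simps)
  qed
  \<comment> \<open>The slope \<open>2/5\<close> lies below \<open>F r / r\<close>, since
    \<open>r < c/4\<close>, and below \<open>1/3 + 2/27\<close>, the least rate at which the final
    bound on \<open>F y\<close> grows with \<open>y\<close>, so \<open>y = r\<close> is optimal. It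
    is still large enough to make the upper third of \<open>[0, y]\<close> more than half
    full.\<close>
  have "continuous_on {0..r} (\<lambda>t. F t - 2/5 * t)" by (intro continuous_intros F_cont)
  then obtain y where y: "0 \<le> y" "y \<le> r" and y_max: "\<And>t. 0 \<le> t \<Longrightarrow> t \<le> r \<Longrightarrow> F t - 2/5 * t \<le> F y - 2/5 * y"
    using continuous_attains_sup[of "{0..r}" "\<lambda>t. F t - 2/5 * t"] r_pos by (auto simp: less_imp_le)
  have Fy: "F r - 2/5 * (r - y) \<le> F y" using y_max[of r] r_pos by argo
  have Fy_pos: "2/5 * y < F y" using Fy Fr m_high c by (simp add: r_def field_simps)
  then have "y \<noteq> 0" using F_0 by auto
  then have "0 < y" using y by simp
  have "m < y" using Fy_pos F_mono[of y m] m \<open>0 < y\<close> by (cases "m < y") auto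
  have y_cl: "y \<in> closure A"
  proof -
    obtain w where w: "w \<in> closure A" "0 \<le> w" "w \<le> y" "F w = F y"
      using last_point[of 0 y] F_empty[of 0 y] y Fy_pos F_0 by (metis less_le_not_le mult_nonneg_nonneg zero_le_divide_iff zero_le_numeral)
    then have "w = y" using y_max[of w] y by simp
    then show ?thesis using w by simp
  qed
  have "F (y/9) \<le> 0" using F_mono[of "y/9" m] m y m_low m_high c by (simp add: r_def)
  then have a1: "F (y/3) \<le> y/9" using upper_two_thirds[of "y/3"] y by simp
  have a2: "F (2*y/3) - F (y/3) \<le> y/9"
  proof -
    have "3 * (1 - 2/5) * (F (2*y/3) - F (y/3)) \<le> (1 - 2*(2/5)) * (2*y - 3*(y/3))"
    proof (rule schnirelmann[OF y_cl])
      show "2/5 * (y - t) \<le> F y - F t" if "0 \<le> t" "t \<le> y" for t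
        using y_max[of t] that y by (simp add: field_simps)
    qed (use y in auto)
    then show ?thesis by simp
  qed
  have "m \<le> y/3"
  proof (rule ccontr)
    assume "\<not> m \<le> y/3"
    then have "F (y/3) \<le> 0" using F_mono[of "y/3" m] m by simp
    then show False using upper_two_thirds[of y] y Fy_pos \<open>0 < y\<close> by simp
  qed
  have 2: "F y - F (2*y/9 + m/3) \<le> y/3"
  proof (rule descent[OF y_cl \<open>0 < y\<close> m(1,2) \<open>m \<le> y/3\<close>])
    show "y/3 < 2 * (F y - F (2*y/3))" using a1 a2 Fy_pos \<open>0 < y\<close> by simp
    fix b v assume "b - 2*y/3 \<le> y/3 - (F y - F (2*y/3))"
    then have "b - 2*y/3 \<le> m" using a1 a2 Fy Fr y m_low m_high c(2) r_def by argo
    then show "b - 2*y/3 \<le> m \<or> b - 2*y/3 \<le> 3 * v - y" ..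
  qed
  define s where "s = 2*y/9 + m/3"
  have "m < s"
  proof (rule ccontr)
    assume "\<not> m < s"
    then have "F s \<le> 0" using F_mono[of s m] m by simp
    then show False using 2 Fy_pos \<open>0 < y\<close> by (simp add: s_def)
  qed
  have s1: "F s \<le> s - m" using F_lip[of m s] \<open>m < s\<close> m by simp
  have "F (s/3) \<le> 0" using F_mono[of "s/3" m] m y m_low m_high c by (simp add: s_def r_def)
  then have s2: "F s \<le> s/3" using upper_two_thirds[of s] \<open>m < s\<close> m by simp
  have 3: "F y - F s \<le> y/3" using 2 by (simp add: s_def)
  note bounds = 1 Fc Fr Fy 3 s1 s2 y(2) s_def r_def
  \<comment> \<open>The bounds \<open>s - m\<close> and \<open>s/3\<close> meet at
    \<open>2 * s = 3 * m\<close>. With \<open>y = r\<close> this is \<open>m = 8/177 * c\<close>,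
    where the chain of bounds gives exactly \<open>77/177 * c\<close>.\<close>
  have m8: "m = 8/177 * c" using bounds by (intro order.antisym; argo)
  have yr: "y = r" using bounds m8 by (intro order.antisym; argo)
  have r42: "r = 42/177 * c" using m8 r_def by argo
  then have s12: "s = 12/177 * c" using m8 yr s_def by argo
  show "F c \<le> 77/177 * c" using bounds m8 by argo
  show "m = 8/177 * c" by (fact m8)
  have "F s = 4/177 * c" using bounds m8 yr by argo
  then show "F (12/177 * c) = 4/177 * c" by (simp add: s12)
  have "F r = 18/177 * c" using bounds m8 yr by argo
  then show "F (42/177 * c) = 18/177 * c" by (simp add: r42)
qed

section \<open>Gaps forced by full intervals\<close>

text \<open>Otherwise \<open>[p, q]\<close> meets the interval from \<open>(x + p')/3\<close> to
  \<open>(x + q')/3\<close> in some \<open>[lo, hi]\<close> of positive length. \<open>A\<close>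
  fills it and its image under \<open>3 * t - x\<close>, twice what \<open>third\<close>
  allows.\<close>

lemma full_intervals_avoid:
  assumes full: "F q - F p = q - p" "F q' - F p' = q' - p'" and pq: "p < q" "p' < q'" and x: "x \<in> A"
  shows "x \<le> 3 * p - q' \<or> 3 * q - p' \<le> x"
proof (rule ccontr)
  assume "\<not> ?thesis"
  then have x': "3 * p - q' < x" "x < 3 * q - p'" by auto
  define lo hi where "lo = max p ((x + p')/3)" and "hi = min q ((x + q')/3)"
  have lh: "lo < hi" "p \<le> lo" "hi \<le> q"
    unfolding lo_def hi_def min_less_iff_conj max_less_iff_conj using x' pq by auto
  have "(x + p')/3 \<le> lo" "hi \<le> (x + q')/3"
    unfolding lo_def hi_def by (rule max.cobounded2, rule min.cobounded2)
  then have lh': "p' \<le> 3 * lo - x" "3 * hi - x \<le> q'" by argo+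
  have "F hi - F lo = hi - lo"
    using F_lip[OF lh(2)] F_lip[of lo hi] F_lip[OF lh(3)] full(1) lh(1) by simp
  moreover have "F (3 * hi - x) - F (3 * lo - x) = 3 * (hi - lo)"
    using F_lip[OF lh'(1)] F_lip[of "3 * lo - x" "3 * hi - x"] F_lip[OF lh'(2)] full(2) lh(1) by simp
  moreover have "x \<in> closure A" using x closure_subset by auto
  ultimately show False
    using third[of x "3 * lo - x" "3 * hi - x"] lh by simp
qed

end

section \<open>Inclusion in one of the seven sets\<close>

theorem theorem1p2:
  fixes A :: "real set"
  assumes "A \<in> sets lebesgue"
    and "A \<subseteq> {0..1}"
    and "three_sum_free A"
    and "measure lebesgue A = 77/177"
  shows "\<exists>B\<in>calA_family. A \<subseteq> B"
proof -
  have "bounded A" using assms(2) bounded_subset bounded_closed_interval by blast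
  then have "A \<in> lmeasurable" using assms(1) by (rule bounded_set_imp_lmeasurable)
  then interpret sum_free_set A
    using assms by unfold_locales auto
  have F1: "F 1 = 77/177"
    using assms(2,4) by (simp add: cum_def Int_absorb2 subset_iff)
  have ne: "A \<inter> {0..1} \<noteq> {}" using assms(2,4) by (auto simp: Int_absorb2)
  obtain m where m: "m \<in> closure A" "0 \<le> m" "F m = 0"
    using first_point[OF ne] F_0 by metis
  have le: "F t \<le> 77/177 * t" if t: "0 \<le> t" "t \<le> 1" for t
  proof (rule ccontr)
    assume neg: "\<not> F t \<le> 77/177 * t"
    \<comment> \<open>A maximum point \<open>y\<close> of the excess satisfies the hypotheses of
      \<open>extremal_values\<close>, whose first conclusion denies a positive excess.\<close>
    have "continuous_on {0..1} (\<lambda>t. F t - 77/177 * t)" by (intro continuous_intros F_cont)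
    then obtain y where y: "0 \<le> y" "y \<le> 1"
      and y_max: "\<And>t. 0 \<le> t \<Longrightarrow> t \<le> 1 \<Longrightarrow> F t - 77/177 * t \<le> F y - 77/177 * y"
      using continuous_attains_sup[of "{0..1}" "\<lambda>t. F t - 77/177 * t"] by auto
    have Fy: "77/177 * y < F y" using y_max[OF t] neg by simp
    have "A \<inter> {0..y} \<noteq> {}"
      using F_empty[of 0 y] y Fy F_0 by auto
    then obtain w where w: "w \<in> closure A" "0 \<le> w" "w \<le> y" "F w = F y"
      using last_point by metis
    then have "y \<in> closure A" using y_max[of w] y by (cases "w = y") auto
    moreover have "0 < y" using Fy F_0 y by (cases "y = 0") auto
    moreover have "77/177 * (y - t) \<le> F y - F t" if "0 \<le> t" "t \<le> y" for t
      using y_max[of t] that y by (simp add: field_simps)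
    ultimately have "F y \<le> 77/177 * y" using extremal_values(1)[of y m] m by blast
    then show False using Fy by simp
  qed
  have top: "77/177 * (1 - t) \<le> F 1 - F t" if "0 \<le> t" "t \<le> 1" for t
    using le[OF that] F1 by (simp add: field_simps)
  obtain w where "w \<in> closure A" "0 \<le> w" "w \<le> 1" "F w = F 1"
    using last_point[OF ne] by metis
  then have cl: "1 \<in> closure A" using le[of w] F1 by (cases "w = 1") auto
  note extremal1 = extremal_values[OF cl zero_less_one _ _ _ top, simplified]
  have m8: "m = 8/177" and F12: "F (12/177) = 4/177" and F42: "F (42/177) = 18/177"
    using extremal1(2-4)[of m] m by simp_all
  \<comment> \<open>A smaller point of \<open>A\<close> would have no mass below it and so could
    serve as \<open>m\<close>, whose value is forced.\<close>
  have low: "8/177 \<le> x" if "x \<in> A" for x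
  proof (rule ccontr)
    assume "\<not> 8/177 \<le> x"
    moreover have "x \<in> closure A" "0 \<le> x" using that nonneg closure_subset by auto
    moreover have "F x = 0" using F_mono[of x m] F_nonneg[of x] m m8 \<open>\<not> 8/177 \<le> x\<close> by simp
    ultimately show False using extremal1(2)[of x] by simp
  qed
  have I1: "F (12/177) - F (8/177) = 12/177 - 8/177" using F12 m m8 by simp
  \<comment> \<open>In units of 1/177, \<open>3 * I - I\<close> for \<open>I = (8, 12)\<close> is
    \<open>(12, 28)\<close>.\<close>
  have gap1: "x \<le> 12/177 \<or> 28/177 \<le> x" if "x \<in> A" for x
    using full_intervals_avoid[OF I1 I1 _ _ that] by simp
  have "F (28/177) = F (12/177)" by (rule F_const) (use gap1 in force)+
  then have I2: "F (42/177) - F (28/177) = 42/177 - 28/177" using F12 F42 by simp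
  \<comment> \<open>In units of 1/177, with \<open>J = (28, 42)\<close>, the sets
    \<open>3 * J - I = (72, 118)\<close> and \<open>3 * J - J = (42, 98)\<close> overlap and cover
    \<open>(42, 118)\<close>.\<close>
  have gap2: "x \<le> 42/177 \<or> 118/177 \<le> x" if "x \<in> A" for x
    using full_intervals_avoid[OF I2 I1 _ _ that] full_intervals_avoid[OF I2 I2 _ _ that] by force
  \<comment> \<open>The defaults avoid the excluded triple: it arises only if all three of its
    points lie in \<open>A\<close>, but \<open>8/177 + 2/3 = 3 * (14/59)\<close>.\<close>
  define p1 :: real where "p1 = (if 8/177 \<in> A then 8/177 else 4/59)"
  define p2 :: real where "p2 = (if 14/59 \<in> A then 14/59 else 28/177)"
  define p3 :: real where "p3 = (if 2/3 \<in> A then 2/3 else 1)"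
  have "\<not> (8/177 \<in> A \<and> 4/59 \<in> A)" "\<not> (28/177 \<in> A \<and> 14/59 \<in> A)" "\<not> (2/3 \<in> A \<and> 1 \<in> A)"
    and triple: "\<not> (8/177 \<in> A \<and> 14/59 \<in> A \<and> 2/3 \<in> A)"
    using freeD[of "4/59" "4/59" "8/177"] freeD[of "14/59" "14/59" "28/177"] freeD[of 1 1 "2/3"]
      freeD[of "8/177" "2/3" "14/59"] by auto
  then have ends: "8/177 \<in> A \<Longrightarrow> p1 = 8/177" "4/59 \<in> A \<Longrightarrow> p1 = 4/59" "28/177 \<in> A \<Longrightarrow> p2 = 28/177"
    "14/59 \<in> A \<Longrightarrow> p2 = 14/59" "2/3 \<in> A \<Longrightarrow> p3 = 2/3" "1 \<in> A \<Longrightarrow> p3 = 1"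
    by (auto simp: p1_def p2_def p3_def)
  have "A \<subseteq> calA0 \<union> {p1, p2, p3}"
  proof
    fix x assume x: "x \<in> A"
    then have "x \<in> {8/177..4/59} \<union> {28/177..14/59} \<union> {2/3..1}"
      using low[OF x] gap1[OF x] gap2[OF x] assms(2) by auto
    then have "x \<in> calA0 \<or> x \<in> {8/177, 4/59, 28/177, 14/59, 2/3, 1}"
      by (auto simp: calA0_def)
    then show "x \<in> calA0 \<union> {p1, p2, p3}"
    proof
      assume "x \<in> {8/177, 4/59, 28/177, 14/59, 2/3, 1}"
      then show ?thesis using x ends by (elim insertE emptyE) simp_all
    qed simp
  qed
  moreover have "calA0 \<union> {p1, p2, p3} \<in> calA_family"
  proof -
    have "\<not> (p1 = 8/177 \<and> p2 = 14/59 \<and> p3 = 2/3)"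
      using triple by (auto simp: p1_def p2_def p3_def split: if_splits)
    moreover have "p1 \<in> {8/177, 4/59}" "p2 \<in> {28/177, 14/59}" "p3 \<in> {2/3, 1}"
      by (auto simp: p1_def p2_def p3_def)
    ultimately show ?thesis unfolding calA_family_def by blast
  qed
  ultimately show ?thesis by blast
qed

end
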